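(* Let $Q$ be a finite connected quandle with elements $1,2,\dots,n$ naturally ordered and with profile $\{1,\ell_1,\ell_2,\dots,\ell_k\}$, where $k\ge 1$ and $1\le\ell_1\le\ell_2\le\cdots\le\ell_k$. For any reordering $\mu$ which is natural with respect to $r_q$ for some $q\in Q$, there is a natural reordering $\nu$ with respect to $r_n$ such that the quandle matrices of $Q$ after reordering by $\mu$ and after reordering by $\nu$ coincide. Moreover, $\nu$ can be taken so that, for some integer $m$ with $1\le m\le k$ and $\ell_m=\ell_k$, one has $\nu\bigl((\sum_{j=1}^{m-1}\ell_j)+i\bigr)=(\sum_{j=1}^{k-1}\ell_j)+i$ for every integer $i$ with $1\le i\le\ell_m$. In particular, when $k\ge 2$ and $\ell_{k-1}<\ell_k$, $\nu$ can be taken so that $\nu(i)=i$ for every integer $i$ with $(\sum_{j=1}^{k-1}\ell_j)+1\le i\le n$.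
   Context: A quandle is a set $Q$ with a binary operation $*$ such that: (1) $a*a=a$ for all $a\in Q$; (2) for all $a,b\in Q$ there is a unique $c\in Q$ with $a=c*b$; (3) $(a*b)*c=(a*c)*(b*c)$ for all $a,b,c\in Q$. For $b\in Q$ let $r_b:Q\to Q$, $r_b(x)=x*b$ (a bijection), and write $a\,\bar{*}\,b=r_b^{-1}(a)$. $Q$ is connected if for every $a\in Q$ the orbit $\{(\cdots((a\star_1 b_1)\star_2 b_2)\cdots\star_m b_m) : m\ge 0,\ b_i\in Q,\ \star_i\in\{*,\bar{*}\}\}$ equals $Q$. Let $Q$ be a finite connected quandle with underlying set $\{1,\dots,n\}$. In this case all the permutations $r_1,\dots,r_n$ are conjugate in the symmetric group; the profile of $Q$ is the multiset of lengths of the cycles in the disjoint cycle decomposition of $r_n$ (cycles of length $1$ included). Since $r_n(n)=n$, the profile contains $1$ and is written $\{1,\ell_1,\dots,\ell_k\}$. The cycle notation $(i_1\ i_2\ \cdots\ i_\ell)$ means $i_1\mapsto i_2\mapsto\cdots\mapsto i_\ell\mapsto i_1$. Natural reordering: a bijection $\nu:\{1,\dots,n\}\to\{1,\dots,n\}$ is a natural reordering with respect to $r_q$ ($q\in Q$) if for some presentation of $r_q$ as a product of disjoint cycles $r_q=(i_{11}\ i_{12}\cdots i_{1\ell_1})(i_{21}\ i_{22}\cdots i_{2\ell_2})\cdots(i_{k1}\ i_{k2}\cdots i_{k\ell_k})(q)$ with $1\le\ell_1\le\ell_2\le\cdots\le\ell_k$, one has $\nu(q)=n$ and $\nu(i_{st})=\bigl(\sum_{j=1}^{s-1}\ell_j\bigr)+t$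 for all $1\le s\le k$, $1\le t\le \ell_s$. The elements of $Q$ are naturally ordered if $r_n=(1\ 2\cdots \ell_1)(\ell_1+1\ \cdots\ \ell_1+\ell_2)\cdots\bigl(\sum_{j=1}^{k-1}\ell_j+1\ \cdots\ \sum_{j=1}^{k-1}\ell_j+\ell_k\bigr)(n)$ with $1\le\ell_1\le\cdots\le\ell_k$. The quandle matrix of $Q$ is the $n\times n$ matrix whose entry in row $i$ and column $j$ is $i*j$. For a bijection $\nu:\{1,\dots,n\}\to\{1,\dots,n\}$, the quandle matrix after reordering by $\nu$ is the matrix whose entry in row $\nu(i)$ and column $\nu(j)$ is $\nu(i*j)$. *)

theory Defs
  imports Main "HOL-Library.FuncSet" "HOL-Library.Multiset" "HOL-Combinatorics.Cycles"
    "HOL-Combinatorics.Orbits"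
begin

definition quandle :: "'a set \<Rightarrow> ('a \<Rightarrow> 'a \<Rightarrow> 'a) \<Rightarrow> bool" where
  "quandle Q op \<longleftrightarrow>
     (\<forall>a\<in>Q. \<forall>b\<in>Q. op a b \<in> Q) \<and>
     (\<forall>a\<in>Q. op a a = a) \<and>
     (\<forall>a\<in>Q. \<forall>b\<in>Q. \<exists>!c. c \<in> Q \<and> a = op c b) \<and>
     (\<forall>a\<in>Q. \<forall>b\<in>Q. \<forall>c\<in>Q. op (op a b) c = op (op a c) (op b c))"

text \<open>The permutation \<open>r\<^sub>b\<close> of \<open>Q\<close>, extended by the identity outside \<open>Q\<close>, so that it can be
  compared with products of cycles as a function on the whole type.\<close>

definition right_mult :: "'a set \<Rightarrow> ('a \<Rightarrow> 'a \<Rightarrow> 'a) \<Rightarrow> 'a \<Rightarrow> 'a \<Rightarrow> 'a" where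
  "right_mult Q op b = perm_restrict (\<lambda>x. op x b) Q"

definition right_div :: "'a set \<Rightarrow> ('a \<Rightarrow> 'a \<Rightarrow> 'a) \<Rightarrow> 'a \<Rightarrow> 'a \<Rightarrow> 'a" where
  "right_div Q op a b = inv_into Q (right_mult Q op b) a"

inductive_set quandle_orbit :: "'a set \<Rightarrow> ('a \<Rightarrow> 'a \<Rightarrow> 'a) \<Rightarrow> 'a \<Rightarrow> 'a set" for Q op a where
  start: "a \<in> quandle_orbit Q op a"
| mult: "x \<in> quandle_orbit Q op a \<Longrightarrow> b \<in> Q \<Longrightarrow> op x b \<in> quandle_orbit Q op a"
| div: "x \<in> quandle_orbit Q op a \<Longrightarrow> b \<in> Q \<Longrightarrow> right_div Q op x b \<in> quandle_orbit Q op a"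

definition connected_quandle :: "'a set \<Rightarrow> ('a \<Rightarrow> 'a \<Rightarrow> 'a) \<Rightarrow> bool" where
  "connected_quandle Q op \<longleftrightarrow> quandle Q op \<and> (\<forall>a\<in>Q. quandle_orbit Q op a = Q)"

text \<open>The cycles of \<open>r\<^sub>n\<close> are its orbits on \<open>{1..n}\<close>, and their lengths are the cardinalities of
  the orbits; fixed points contribute the length \<open>1\<close>.\<close>

definition profile :: "nat \<Rightarrow> (nat \<Rightarrow> nat \<Rightarrow> nat) \<Rightarrow> nat multiset" where
  "profile n op =
     image_mset card (mset_set (orbit (right_mult {1..n} op n) ` {1..n}))"

text \<open>The indices of \<open>l\<close> and of \<open>i\<close> start at \<open>1\<close>: the presentation is
  \<open>r\<^sub>q = (i 1 1, \<dots>, i 1 (l 1)) \<dots> (i k 1, \<dots>, i k (l k)) (q)\<close>. The cycles are disjoint and cover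
  \<open>{1..n}\<close>, cycles of length \<open>1\<close> included.\<close>

definition cycle_presentation ::
  "nat \<Rightarrow> (nat \<Rightarrow> nat \<Rightarrow> nat) \<Rightarrow> nat \<Rightarrow> nat \<Rightarrow> (nat \<Rightarrow> nat) \<Rightarrow> (nat \<Rightarrow> nat \<Rightarrow> nat) \<Rightarrow> bool" where
  "cycle_presentation n op q k l i \<longleftrightarrow>
     q \<in> {1..n} \<and>
     (\<forall>s\<in>{1..k}. 1 \<le> l s) \<and> mono_on {1..k} l \<and>
     bij_betw (\<lambda>(s, t). i s t) (SIGMA s:{1..k}. {1..l s}) ({1..n} - {q}) \<and>
     right_mult {1..n} op q =
       foldr (\<circ>) (map cycle_of_list (map (\<lambda>s. map (i s) [1..<l s + 1]) [1..<k + 1] @ [[q]])) id"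

definition natural_reordering ::
  "nat \<Rightarrow> (nat \<Rightarrow> nat \<Rightarrow> nat) \<Rightarrow> nat \<Rightarrow> (nat \<Rightarrow> nat) \<Rightarrow> bool" where
  "natural_reordering n op q \<nu> \<longleftrightarrow>
     bij_betw \<nu> {1..n} {1..n} \<and>
     (\<exists>k l i. cycle_presentation n op q k l i \<and>
        \<nu> q = n \<and> (\<forall>s\<in>{1..k}. \<forall>t\<in>{1..l s}. \<nu> (i s t) = (\<Sum>j=1..<s. l j) + t))"

definition naturally_ordered :: "nat \<Rightarrow> (nat \<Rightarrow> nat \<Rightarrow> nat) \<Rightarrow> bool" where
  "naturally_ordered n op \<longleftrightarrow>
     (\<exists>k l. cycle_presentation n op n k l (\<lambda>s t. (\<Sum>j=1..<s. l j) + t))"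

text \<open>Matrices are extensional functions on \<open>{1..n} \<times> {1..n}\<close>, so that equality of
  matrices is equality of functions.\<close>

definition quandle_matrix :: "nat \<Rightarrow> (nat \<Rightarrow> nat \<Rightarrow> nat) \<Rightarrow> nat \<times> nat \<Rightarrow> nat" where
  "quandle_matrix n op = (\<lambda>(i, j)\<in>{1..n} \<times> {1..n}. op i j)"

definition reordered_matrix ::
  "nat \<Rightarrow> (nat \<Rightarrow> nat \<Rightarrow> nat) \<Rightarrow> (nat \<Rightarrow> nat) \<Rightarrow> nat \<times> nat \<Rightarrow> nat" where
  "reordered_matrix n op \<nu> =
     (\<lambda>(a, b)\<in>{1..n} \<times> {1..n}.
        \<nu> (quandle_matrix n op (inv_into {1..n} \<nu> a, inv_into {1..n} \<nu> b)))"

lemma reordered_matrix_entry: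
  assumes "bij_betw \<nu> {1..n} {1..n}" "i \<in> {1..n}" "j \<in> {1..n}"
  shows "reordered_matrix n op \<nu> (\<nu> i, \<nu> j) = \<nu> (op i j)"
proof -
  have "\<nu> i \<in> {1..n}" "\<nu> j \<in> {1..n}"
    using assms bij_betwE by blast+
  moreover have "inv_into {1..n} \<nu> (\<nu> i) = i" "inv_into {1..n} \<nu> (\<nu> j) = j"
    using assms bij_betw_inv_into_left by metis+
  ultimately show ?thesis
    using assms(2,3) by (simp add: reordered_matrix_def quandle_matrix_def)
qed

end

theory Submission
  imports Defs
begin

text \<open>
  Connectedness gives an automorphism \<open>\<phi>\<close> of \<open>Q\<close>, a composition of maps \<open>r\<^sub>b\<close> and their inverses,
  with \<open>\<phi> n = q\<close>. It conjugates \<open>r\<^sub>n\<close> to \<open>r\<^sub>q\<close>, so \<open>\<mu> \<circ> \<phi>\<close> is natural with respect to \<open>r\<^sub>n\<close>,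
  and the two reordered matrices agree because \<open>\<phi>\<close> preserves the operation. The automorphism
  \<open>r\<^sub>n\<close> fixes \<open>n\<close>, hence composing further with a power of \<open>r\<^sub>n\<close> loses nothing, and it allows one
  to choose which element of the cycle sent to the last block becomes its first element.
\<close>

subsection \<open>Cycle presentations\<close>

lemma set_upt_Suc: "set [1..<m + 1] = {1..m}"
  by auto

lemma mod_Suc_in_atLeastAtMost:
  fixes t m :: nat
  assumes "t \<in> {1..m}"
  shows "t mod m + 1 \<in> {1..m}"
proof -
  have "t mod m < m" using assms by (intro mod_less_divisor) simp
  then show ?thesis by simp
qed

text \<open>\<open>cyclic_rotation\<close> says that a cycle maps its own list to the list rotated
  by one; the claim is one entry of that equation. Here \<open>t mod m + 1\<close> is the cyclic
  successor on the indices \<open>1..m\<close>, with \<open>m\<close> followed by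
  \<open>1\<close>.\<close>

lemma cycle_of_list_map_upt:
  assumes "inj_on f {1..m}" "t \<in> {1..m}"
  shows "cycle_of_list (map f [1..<m + 1]) (f t) = f (t mod m + 1)"
proof -
  let ?cs = "map f [1..<m + 1]"
  have cyc: "cycle ?cs"
    using assms(1) unfolding distinct_map set_upt_Suc by simp
  have len: "length ?cs = m" by simp
  obtain e where e: "t = e + 1" "e < m"
    using assms(2) by (metis Suc_eq_plus1 Suc_le_eq atLeastAtMost_iff less_eqE plus_1_eq_Suc)
  have nth: "?cs ! j = f (j + 1)" if "j < m" for j
    using that by (simp del: upt_Suc)
  have "map (cycle_of_list ?cs) ?cs ! e = rotate1 ?cs ! e"
    using cyclic_rotation[OF cyc, of 1] by simp
  also have "\<dots> = ?cs ! (Suc e mod m)"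
    using nth_rotate1[of e ?cs] e(2) unfolding len by blast
  also have "\<dots> = f (t mod m + 1)"
    using nth[of "Suc e mod m"] e by simp
  finally have "map (cycle_of_list ?cs) ?cs ! e = f (t mod m + 1)" .
  moreover have "map (cycle_of_list ?cs) ?cs ! e = cycle_of_list ?cs (f t)"
    using nth_map[of e ?cs "cycle_of_list ?cs"] nth[OF e(2)] e(2) unfolding len e(1) by metis
  ultimately show ?thesis by metis
qed

lemma foldr_cycles_Cons:
  "foldr (\<circ>) (map cycle_of_list (map r (s # ss))) id x =
    cycle_of_list (r s) (foldr (\<circ>) (map cycle_of_list (map r ss)) id x)"
  by simp

lemma foldr_cycles_outside:
  assumes "\<And>cs. cs \<in> set css \<Longrightarrow> x \<notin> set cs"
  shows "foldr (\<circ>) (map cycle_of_list css) id x = x"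
  using assms by (induction css) (auto simp: id_outside_supp)

text \<open>Disjointness means that only the cycle of row \<open>s\<close> acts. In the induction,
  either the head cycle is that row and the others fix the point, or the induction hypothesis moves
  the point within row \<open>s\<close> and the head cycle fixes the result.\<close>

lemma foldr_cycles_inside:
  assumes "distinct ss" "inj_on (\<lambda>(s, t). i s t) (SIGMA s:set ss. {1..l s})"
    and "s \<in> set ss" "t \<in> {1..l s}"
  shows "foldr (\<circ>) (map cycle_of_list (map (\<lambda>s. map (i s) [1..<l s + 1]) ss)) id (i s t) =
    i s (t mod l s + 1)"
  using assms
proof (induction ss)
  case Nil
  then show ?case by simp
next
  case (Cons a ss)
  let ?row = "\<lambda>s. map (i s) [1..<l s + 1]"
  let ?g = "foldr (\<circ>) (map cycle_of_list (map ?row ss)) id"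
  \<comment> \<open>Injectivity in the pair of indices makes different rows disjoint.\<close>
  have disj: "i s' t' \<noteq> i s'' t''"
    if "s' \<noteq> s''" "s' \<in> set (a # ss)" "s'' \<in> set (a # ss)" "t' \<in> {1..l s'}" "t'' \<in> {1..l s''}"
    for s' s'' t' t''
    using inj_onD[OF Cons.prems(2), of "(s', t')" "(s'', t'')"] that
    by (auto simp only: mem_Sigma_iff prod.case prod.inject)
  have next_in: "t mod l s + 1 \<in> {1..l s}"
    using Cons.prems(4) by (rule mod_Suc_in_atLeastAtMost)
  show ?case
  proof (cases "s = a")
    case True
    have "?g (i s t) = i s t"
    proof (rule foldr_cycles_outside)
      fix cs assume "cs \<in> set (map ?row ss)"
      then obtain s' where s': "s' \<in> set ss" "cs = ?row s'"
        unfolding set_map by blast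
      then have "s \<noteq> s'" "s' \<in> set (a # ss)" using Cons.prems(1) True by auto
      then have "i s t \<notin> i s' ` {1..l s'}"
        using disj[OF _ Cons.prems(3) _ Cons.prems(4)] by blast
      then show "i s t \<notin> set cs"
        unfolding s'(2) set_map set_upt_Suc .
    qed
    moreover have "inj_on (i a) {1..l a}"
    proof (rule inj_onI)
      fix x y assume "x \<in> {1..l a}" "y \<in> {1..l a}" "i a x = i a y"
      then show "x = y" using inj_onD[OF Cons.prems(2), of "(a, x)" "(a, y)"] by simp
    qed
    ultimately show ?thesis
      using cycle_of_list_map_upt[of "i a" "l a" t] Cons.prems(4) True
      unfolding foldr_cycles_Cons by metis
  next
    case False
    then have s: "s \<in> set ss" using Cons.prems(3) by simp
    have "?g (i s t) = i s (t mod l s + 1)"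
    proof (rule Cons.IH)
      show "inj_on (\<lambda>(s, t). i s t) (SIGMA s:set ss. {1..l s})"
        using Cons.prems(2) by (rule inj_on_subset) auto
      show "distinct ss" using Cons.prems(1) by simp
    qed (fact s Cons.prems(4))+
    moreover have "i s (t mod l s + 1) \<notin> set (?row a)"
      unfolding set_map set_upt_Suc
      using disj[OF False Cons.prems(3) list.set_intros(1) next_in] by blast
    ultimately show ?thesis
      unfolding foldr_cycles_Cons using id_outside_supp by metis
  qed
qed

text \<open>The working form of a presentation: the equation between \<open>r_q\<close> and a
  product of cycles becomes pointwise equations on the entries. This suffices because both functions
  are the identity outside \<open>{1..n}\<close>, and the entries together with \<open>q\<close>
  exhaust \<open>{1..n}\<close>.\<close>

lemma cycle_presentation_iff:
  "cycle_presentation n op q k l i \<longleftrightarrow>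
     q \<in> {1..n} \<and> (\<forall>s\<in>{1..k}. 1 \<le> l s) \<and> mono_on {1..k} l \<and>
     bij_betw (\<lambda>(s, t). i s t) (SIGMA s:{1..k}. {1..l s}) ({1..n} - {q}) \<and>
     op q q = q \<and> (\<forall>s\<in>{1..k}. \<forall>t\<in>{1..l s}. op (i s t) q = i s (t mod l s + 1))"
proof -
  let ?rows = "map (\<lambda>s. map (i s) [1..<l s + 1]) [1..<k + 1]"
  let ?F = "foldr (\<circ>) (map cycle_of_list (?rows @ [[q]])) id"
  have key: "right_mult {1..n} op q = ?F \<longleftrightarrow>
      op q q = q \<and> (\<forall>s\<in>{1..k}. \<forall>t\<in>{1..l s}. op (i s t) q = i s (t mod l s + 1))"
    if q: "q \<in> {1..n}"
      and bij: "bij_betw (\<lambda>(s, t). i s t) (SIGMA s:{1..k}. {1..l s}) ({1..n} - {q})"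
  proof -
    define F where "F = ?F"
    \<comment> \<open>The one-element cycle \<open>[q]\<close> contributes the identity, so only the
      rows remain.\<close>
    have F_rows: "F = foldr (\<circ>) (map cycle_of_list ?rows) id"
      unfolding F_def by (simp del: upt_Suc)
    have img: "(\<lambda>(s, t). i s t) ` (SIGMA s:{1..k}. {1..l s}) = {1..n} - {q}"
      using bij by (rule bij_betw_imp_surj_on)
    have in_n: "i s t \<in> {1..n} - {q}" if "s \<in> {1..k}" "t \<in> {1..l s}" for s t
      using imageI[of "(s, t)" "SIGMA s:{1..k}. {1..l s}" "\<lambda>(s, t). i s t"] that
      unfolding img by simp
    have Fin: "F (i s t) = i s (t mod l s + 1)" if "s \<in> {1..k}" "t \<in> {1..l s}" for s t
      unfolding F_rows using that bij
      by (intro foldr_cycles_inside) (simp_all only: bij_betw_def set_upt_Suc distinct_upt)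
    have Fout: "F x = x" if "x \<notin> {1..n} - {q}" for x
      unfolding F_rows
    proof (rule foldr_cycles_outside)
      fix cs assume "cs \<in> set ?rows"
      then obtain s where s: "s \<in> {1..k}" "cs = map (i s) [1..<l s + 1]"
        unfolding set_map set_upt_Suc by blast
      show "x \<notin> set cs"
        unfolding s(2) set_map set_upt_Suc using in_n[OF s(1)] that by blast
    qed
    have "right_mult {1..n} op q = F \<longleftrightarrow> (\<forall>x\<in>insert q ({1..n} - {q}). op x q = F x)"
    proof
      assume eq: "right_mult {1..n} op q = F"
      show "\<forall>x\<in>insert q ({1..n} - {q}). op x q = F x"
        using q by (auto simp: eq[symmetric] right_mult_def perm_restrict_def)
    next
      assume "\<forall>x\<in>insert q ({1..n} - {q}). op x q = F x"
      then show "right_mult {1..n} op q = F"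
        using q Fout by (intro ext) (auto simp: right_mult_def perm_restrict_def)
    qed
    also have "\<dots> \<longleftrightarrow> op q q = q \<and>
        (\<forall>s\<in>{1..k}. \<forall>t\<in>{1..l s}. op (i s t) q = i s (t mod l s + 1))"
      unfolding img[symmetric] using Fin Fout[of q] by auto
    finally show ?thesis
      unfolding F_def .
  qed
  show ?thesis
    \<comment> \<open>\<open>conj_cong\<close> makes the earlier conjuncts available as the premises
      of \<open>key\<close>.\<close>
    unfolding cycle_presentation_def by (intro conj_cong refl key)
qed

lemma cycle_presentation_image:
  assumes "cycle_presentation n op q k l i"
  shows "(\<lambda>(s, t). i s t) ` (SIGMA s:{1..k}. {1..l s}) = {1..n} - {q}"
  using assms unfolding cycle_presentation_iff bij_betw_def by blast

lemma cycle_presentation_inj: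
  assumes "cycle_presentation n op q k l i"
  shows "inj_on (\<lambda>(s, t). i s t) (SIGMA s:{1..k}. {1..l s})"
  using assms unfolding cycle_presentation_iff bij_betw_def by blast

lemma cycle_presentation_in:
  assumes "cycle_presentation n op q k l i" "s \<in> {1..k}" "t \<in> {1..l s}"
  shows "i s t \<in> {1..n} - {q}"
  using imageI[of "(s, t)" "SIGMA s:{1..k}. {1..l s}" "\<lambda>(s, t). i s t"] assms(2,3)
  unfolding cycle_presentation_image[OF assms(1)] by simp

lemma cycle_presentation_cases:
  assumes "cycle_presentation n op q k l i" "x \<in> {1..n}" "x \<noteq> q"
  obtains s t where "s \<in> {1..k}" "t \<in> {1..l s}" "x = i s t"
proof -
  have "x \<in> (\<lambda>(s, t). i s t) ` (SIGMA s:{1..k}. {1..l s})"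
    unfolding cycle_presentation_image[OF assms(1)] using assms(2,3) by blast
  then show ?thesis using that by auto
qed

text \<open>Lengths and entries matter only at valid indices, and the cyclic successor of a valid
  index is valid. This permits replacing existentially obtained lengths and entries by prescribed
  ones.\<close>

lemma cycle_presentation_cong:
  assumes "\<And>s. s \<in> {1..k} \<Longrightarrow> l s = l' s"
    and "\<And>s t. s \<in> {1..k} \<Longrightarrow> t \<in> {1..l s} \<Longrightarrow> i s t = i' s t"
    and "cycle_presentation n op q k l i"
  shows "cycle_presentation n op q k l' i'"
proof -
  have Sig: "(SIGMA s:{1..k}. {1..l s}) = (SIGMA s:{1..k}. {1..l' s})"
    using assms(1) by auto
  have bij: "bij_betw (\<lambda>(s, t). i' s t) (SIGMA s:{1..k}. {1..l' s}) ({1..n} - {q}) \<longleftrightarrow>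
      bij_betw (\<lambda>(s, t). i s t) (SIGMA s:{1..k}. {1..l s}) ({1..n} - {q})"
    unfolding Sig[symmetric] using assms(2) by (intro bij_betw_cong) auto
  have nxt: "t mod l s + 1 \<in> {1..l s}" if "t \<in> {1..l s}" for s t
    using that by (rule mod_Suc_in_atLeastAtMost)
  show ?thesis
    unfolding cycle_presentation_iff
  proof (intro conjI ballI)
    show "q \<in> {1..n}" "op q q = q"
      using assms(3) unfolding cycle_presentation_iff by blast+
    show "bij_betw (\<lambda>(s, t). i' s t) (SIGMA s:{1..k}. {1..l' s}) ({1..n} - {q})"
      using assms(3) bij unfolding cycle_presentation_iff by blast
    have "mono_on {1..k} l"
      using assms(3) unfolding cycle_presentation_iff by blast
    then show "mono_on {1..k} l'"
      using assms(1) unfolding mono_on_def by metis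
    show "1 \<le> l' s" if "s \<in> {1..k}" for s
      using assms(1)[OF that] assms(3) that unfolding cycle_presentation_iff by metis
    fix s t assume st: "s \<in> {1..k}" "t \<in> {1..l' s}"
    then have t: "t \<in> {1..l s}" using assms(1) by simp
    have "op (i s t) q = i s (t mod l s + 1)"
      using assms(3) st(1) t unfolding cycle_presentation_iff by blast
    then show "op (i' s t) q = i' s (t mod l' s + 1)"
      using assms(1)[OF st(1)] assms(2)[OF st(1) t] assms(2)[OF st(1) nxt[OF t]] by simp
  qed
qed

section \<open>Powers and orbits of the presented permutation\<close>

lemma cycle_presentation_funpow:
  assumes "cycle_presentation n op q k l i" "s \<in> {1..k}" "e < l s"
  shows "(right_mult {1..n} op q ^^ d) (i s (e + 1)) = i s ((e + d) mod l s + 1)"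
proof (induction d)
  case 0
  then show ?case using assms(3) by simp
next
  case (Suc d)
  \<comment> \<open>With the zero-based position \<open>e\<close>, applying the permutation
    \<open>d\<close> times is addition of \<open>d\<close> modulo the row length; the final
    \<open>+ 1\<close> returns to one-based indices.\<close>
  let ?t = "(e + d) mod l s + 1"
  have t: "?t \<in> {1..l s}"
    using mod_less_divisor[of "l s" "e + d"] assms(3) by (simp add: Suc_le_eq)
  have "(right_mult {1..n} op q ^^ Suc d) (i s (e + 1)) = right_mult {1..n} op q (i s ?t)"
    by (simp only: funpow.simps comp_apply Suc.IH)
  also have "\<dots> = op (i s ?t) q"
    using cycle_presentation_in[OF assms(1,2) t] by (simp add: right_mult_def perm_restrict_def)
  also have "\<dots> = i s (?t mod l s + 1)"
    using assms(1,2) t unfolding cycle_presentation_iff by blast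
  also have "?t mod l s = (e + Suc d) mod l s"
    by (simp add: mod_Suc_eq)
  finally show ?case .
qed

lemma cycle_presentation_funpow_first:
  assumes "cycle_presentation n op q k l i" "s \<in> {1..k}" "t \<in> {1..l s}"
  shows "(right_mult {1..n} op q ^^ (t - 1)) (i s 1) = i s t"
proof (cases t)
  case (Suc e)
  then have "0 < l s" "e < l s" using assms(3) by auto
  then show ?thesis
    using cycle_presentation_funpow[OF assms(1,2), of 0 e] Suc by simp
qed (use assms(3) in simp)

lemma cycle_presentation_orbit:
  assumes "cycle_presentation n op q k l i" "s \<in> {1..k}" "t \<in> {1..l s}"
  shows "orbit (right_mult {1..n} op q) (i s t) = i s ` {1..l s}"
proof -
  let ?f = "right_mult {1..n} op q"
  define e where "e = t - 1"
  have e: "t = e + 1" "e < l s" using assms(3) by (auto simp: e_def)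
  have pow: "(?f ^^ d) (i s t) = i s ((e + d) mod l s + 1)" for d
    unfolding e(1) using assms(1,2) e(2) by (rule cycle_presentation_funpow)
  have "i s t' \<in> orbit ?f (i s t)" if "t' \<in> {1..l s}" for t'
  proof -
    \<comment> \<open>Members of \<open>orbit\<close> are reached by at least one application, so
      the exponent must be positive even for \<open>t' = t\<close>. Going forward past the end of
      the row ensures this: \<open>e + d\<close> exceeds the target position by exactly one full
      turn.\<close>
    define d where "d = t' - 1 + (l s - e)"
    have ed: "e + d = (t' - 1) + l s" using e(2) by (simp add: d_def)
    have "t' - 1 < l s" using that by (cases t') auto
    then have "(e + d) mod l s = t' - 1" by (simp only: ed mod_add_self2 mod_less)
    then have "(?f ^^ d) (i s t) = i s t'" unfolding pow using that by simp
    moreover have "0 < d" using e(2) by (simp add: d_def)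
    ultimately show ?thesis by (metis (mono_tags, lifting) mem_Collect_eq orbit_altdef)
  qed
  moreover have "orbit ?f (i s t) \<subseteq> i s ` {1..l s}"
  proof
    fix x assume "x \<in> orbit ?f (i s t)"
    then obtain d where "x = (?f ^^ d) (i s t)" by (auto simp: orbit_altdef)
    moreover have "(e + d) mod l s + 1 \<in> {1..l s}"
      using e(2) mod_less_divisor[of "l s" "e + d"] by (simp add: Suc_le_eq)
    ultimately show "x \<in> i s ` {1..l s}" using pow by blast
  qed
  ultimately show ?thesis by blast
qed

section \<open>Row lengths and the profile\<close>

lemma cycle_presentation_card:
  assumes "cycle_presentation n op q k l i" "s \<in> {1..k}"
  shows "card (i s ` {1..l s}) = l s"
proof -
  have "inj_on (i s) {1..l s}"
  proof (rule inj_onI)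
    fix t t' assume "t \<in> {1..l s}" "t' \<in> {1..l s}" "i s t = i s t'"
    then show "t = t'"
      using inj_onD[OF cycle_presentation_inj[OF assms(1)], of "(s, t)" "(s, t')"] assms(2) by simp
  qed
  then show ?thesis by (simp add: card_image)
qed

text \<open>The orbits of \<open>r_n\<close> are the rows and the singleton \<open>{n}\<close>.
  Since the profile is computed from a set of orbits, these must be shown pairwise different, so
  that equal lengths are still counted with multiplicity.\<close>

lemma profile_cycle_presentation:
  assumes "cycle_presentation n op n k l i"
  shows "profile n op = {#1#} + image_mset l (mset_set {1..k})"
proof -
  let ?f = "right_mult {1..n} op n"
  let ?row = "\<lambda>s. i s ` {1..l s}"
  have n: "n \<in> {1..n}" "op n n = n" and l: "\<And>s. s \<in> {1..k} \<Longrightarrow> 1 \<le> l s"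
    using assms unfolding cycle_presentation_iff by blast+
  note inj = cycle_presentation_inj[OF assms]
  have fn: "?f n = n" using n by (simp add: right_mult_def perm_restrict_def)
  have "(?f ^^ d) n = n" for d by (induction d) (use fn in simp_all)
  then have orb_n: "orbit ?f n = {n}" by (auto simp: orbit_altdef)
  have "orbit ?f ` {1..n} = insert {n} (?row ` {1..k})"
  proof (intro equalityI subsetI)
    fix X assume "X \<in> orbit ?f ` {1..n}"
    then obtain x where x: "x \<in> {1..n}" "X = orbit ?f x" by blast
    show "X \<in> insert {n} (?row ` {1..k})"
    proof (cases "x = n")
      case False
      then obtain s t where "s \<in> {1..k}" "t \<in> {1..l s}" "x = i s t"
        using cycle_presentation_cases[OF assms x(1)] by blast
      then show ?thesis
        using x(2) cycle_presentation_orbit[OF assms] by blast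
    qed (use x orb_n in simp)
  next
    fix X assume "X \<in> insert {n} (?row ` {1..k})"
    then consider "X = {n}" | s where "s \<in> {1..k}" "X = ?row s" by blast
    then show "X \<in> orbit ?f ` {1..n}"
    proof cases
      case 1
      then show ?thesis using n(1) orb_n by blast
    next
      case 2
      \<comment> \<open>Positive length makes the row nonempty, so it is the orbit of its first
        entry.\<close>
      then have "1 \<in> {1..l s}" using l by simp
      then show ?thesis
        using cycle_presentation_orbit[OF assms 2(1)] cycle_presentation_in[OF assms 2(1)] 2(2)
        by blast
    qed
  qed
  moreover have "{n} \<notin> ?row ` {1..k}"
  proof
    assume "{n} \<in> ?row ` {1..k}"
    then obtain s where s: "s \<in> {1..k}" "{n} = ?row s" by blast
    then obtain t where "t \<in> {1..l s}" "n = i s t" by blast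
    then show False using cycle_presentation_in[OF assms s(1)] by blast
  qed
  moreover have row_inj: "inj_on ?row {1..k}"
  proof (rule inj_onI)
    fix s s' assume s: "s \<in> {1..k}" "s' \<in> {1..k}" "?row s = ?row s'"
    have "i s 1 \<in> ?row s" using l[OF s(1)] by simp
    then obtain t where "t \<in> {1..l s'}" "i s 1 = i s' t" using s(3) by blast
    then show "s = s'"
      using inj_onD[OF inj, of "(s, 1)" "(s', t)"] s l[OF s(1)] by simp
  qed
  ultimately have "profile n op = add_mset 1 (image_mset card (mset_set (?row ` {1..k})))"
    by (simp add: profile_def)
  also have "mset_set (?row ` {1..k}) = image_mset ?row (mset_set {1..k})"
    using image_mset_mset_set[OF row_inj] by simp
  also have "image_mset card \<dots> = image_mset l (mset_set {1..k})"
    using cycle_presentation_card[OF assms]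
    by (auto simp: multiset.map_comp intro!: image_mset_cong)
  finally show ?thesis by simp
qed

text \<open>A sorted list is determined by its multiset; monotonicity says that the lists of values
  are sorted.\<close>

lemma sorted_multiset_unique:
  fixes l l' :: "nat \<Rightarrow> nat"
  assumes "mono_on {1..k} l" "mono_on {1..k'} l'"
    and "image_mset l (mset_set {1..k}) = image_mset l' (mset_set {1..k'})"
  shows "k = k'" "\<And>s. s \<in> {1..k} \<Longrightarrow> l s = l' s"
proof -
  have mset: "mset (map f [1..<m + 1]) = image_mset f (mset_set {1..m})" for f :: "nat \<Rightarrow> nat" and m
    by (simp add: atLeastLessThanSuc_atLeastAtMost del: upt_Suc)
  have sorted: "sorted (map f [1..<m + 1])" if "mono_on {1..m} f" for f :: "nat \<Rightarrow> nat" and m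
    by (rule sorted_map_mono[OF sorted_upt]) (use that in \<open>simp only: set_upt_Suc\<close>)
  have "sort (map l' [1..<k' + 1]) = map l [1..<k + 1]"
    by (rule properties_for_sort) (simp_all only: mset assms(3) sorted[OF assms(1)])
  then have eq: "map l [1..<k + 1] = map l' [1..<k' + 1]"
    by (simp only: sorted_sort_id[OF sorted[OF assms(2)]])
  then show "k = k'" using map_eq_imp_length_eq[OF eq] by (simp only: length_upt)
  then show "l s = l' s" if "s \<in> {1..k}" for s
    using eq that by (auto simp del: upt_Suc)
qed

text \<open>A natural reordering comes with its own number of cycles and its own lengths. The
  profile determines both, so they may be taken to be the prescribed \<open>k\<close> and
  \<open>l\<close>, which makes different presentations of \<open>r_n\<close> comparable.\<close>

lemma natural_reordering_at_profile:
  assumes "natural_reordering n op n \<nu>" "mono_on {1..k} l"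
    and "profile n op = {#1#} + image_mset l (mset_set {1..k})"
  obtains i where "cycle_presentation n op n k l i"
    and "\<And>s t. s \<in> {1..k} \<Longrightarrow> t \<in> {1..l s} \<Longrightarrow> \<nu> (i s t) = (\<Sum>j=1..<s. l j) + t"
proof -
  obtain k' l' i where cp: "cycle_presentation n op n k' l' i"
    and \<nu>: "\<forall>s\<in>{1..k'}. \<forall>t\<in>{1..l' s}. \<nu> (i s t) = (\<Sum>j=1..<s. l' j) + t"
    using assms(1) unfolding natural_reordering_def by blast
  have "mono_on {1..k'} l'" using cp unfolding cycle_presentation_iff by blast
  moreover have "image_mset l' (mset_set {1..k'}) = image_mset l (mset_set {1..k})"
    using profile_cycle_presentation[OF cp] assms(3) by simp
  ultimately have k: "k' = k" and l: "\<And>s. s \<in> {1..k} \<Longrightarrow> l' s = l s"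
    using sorted_multiset_unique[OF _ assms(2)] by blast+
  have "cycle_presentation n op n k l i"
    using cycle_presentation_cong[OF _ _ cp] l k by blast
  moreover have "\<nu> (i s t) = (\<Sum>j=1..<s. l j) + t" if "s \<in> {1..k}" "t \<in> {1..l s}" for s t
  proof -
    have "(\<Sum>j=1..<s. l' j) = (\<Sum>j=1..<s. l j)" using that(1) l by (intro sum.cong) auto
    then show ?thesis using \<nu> that l k by simp
  qed
  ultimately show ?thesis using that by blast
qed

subsection \<open>Automorphisms\<close>

lemma quandle_laws:
  assumes "quandle Q op"
  shows quandle_closed: "a \<in> Q \<Longrightarrow> b \<in> Q \<Longrightarrow> op a b \<in> Q"
    and quandle_idem: "a \<in> Q \<Longrightarrow> op a a = a"
    and quandle_div_unique: "a \<in> Q \<Longrightarrow> b \<in> Q \<Longrightarrow> \<exists>!c. c \<in> Q \<and> a = op c b"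
    and quandle_distrib:
      "a \<in> Q \<Longrightarrow> b \<in> Q \<Longrightarrow> c \<in> Q \<Longrightarrow> op (op a b) c = op (op a c) (op b c)"
proof -
  note laws = assms[unfolded quandle_def, THEN conjunct1]
    assms[unfolded quandle_def, THEN conjunct2, THEN conjunct1]
    assms[unfolded quandle_def, THEN conjunct2, THEN conjunct2, THEN conjunct1]
    assms[unfolded quandle_def, THEN conjunct2, THEN conjunct2, THEN conjunct2]
  show "op a b \<in> Q" if "a \<in> Q" "b \<in> Q"
    by (rule bspec[OF bspec[OF laws(1) that(1)] that(2)])
  show "op a a = a" if "a \<in> Q"
    by (rule bspec[OF laws(2) that])
  show "\<exists>!c. c \<in> Q \<and> a = op c b" if "a \<in> Q" "b \<in> Q"
    by (rule bspec[OF bspec[OF laws(3) that(1)] that(2)])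
  show "op (op a b) c = op (op a c) (op b c)" if "a \<in> Q" "b \<in> Q" "c \<in> Q"
    by (rule bspec[OF bspec[OF bspec[OF laws(4) that(1)] that(2)] that(3)])
qed

lemma right_mult_apply: "x \<in> Q \<Longrightarrow> right_mult Q op b x = op x b"
  by (simp add: right_mult_def perm_restrict_def)

definition quandle_automorphism :: "'a set \<Rightarrow> ('a \<Rightarrow> 'a \<Rightarrow> 'a) \<Rightarrow> ('a \<Rightarrow> 'a) \<Rightarrow> bool" where
  "quandle_automorphism Q op \<phi> \<longleftrightarrow>
     bij_betw \<phi> Q Q \<and> (\<forall>a\<in>Q. \<forall>b\<in>Q. \<phi> (op a b) = op (\<phi> a) (\<phi> b))"

lemma quandle_automorphism_apply:
  "quandle_automorphism Q op \<phi> \<Longrightarrow> a \<in> Q \<Longrightarrow> b \<in> Q \<Longrightarrow> \<phi> (op a b) = op (\<phi> a) (\<phi> b)"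
  by (simp add: quandle_automorphism_def)

lemma quandle_automorphism_id: "quandle_automorphism Q op id"
  by (simp add: quandle_automorphism_def)

lemma quandle_automorphism_comp:
  assumes "quandle_automorphism Q op \<phi>" "quandle_automorphism Q op \<psi>"
  shows "quandle_automorphism Q op (\<phi> \<circ> \<psi>)"
  using assms bij_betw_trans[of \<psi> Q Q \<phi> Q] bij_betwE[of \<psi> Q Q]
  by (simp add: quandle_automorphism_def)

lemma quandle_automorphism_funpow:
  assumes "quandle_automorphism Q op \<phi>"
  shows "quandle_automorphism Q op (\<phi> ^^ d)"
  by (induction d)
    (simp_all only: funpow.simps quandle_automorphism_id quandle_automorphism_comp assms)

lemma quandle_automorphism_inv_into:
  assumes "quandle Q op" "quandle_automorphism Q op \<phi>"
  shows "quandle_automorphism Q op (inv_into Q \<phi>)"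
proof -
  have bij: "bij_betw \<phi> Q Q" using assms(2) by (simp add: quandle_automorphism_def)
  have "inv_into Q \<phi> (op a b) = op (inv_into Q \<phi> a) (inv_into Q \<phi> b)"
    if ab: "a \<in> Q" "b \<in> Q" for a b
  proof -
    obtain x y where "x \<in> Q" "\<phi> x = a" "y \<in> Q" "\<phi> y = b"
      using bij ab by (metis bij_betw_imp_surj_on imageE)
    note xy = this
    have "op x y \<in> Q" using quandle_closed[OF assms(1)] xy by blast
    moreover have "\<phi> (op x y) = op a b"
      using quandle_automorphism_apply[OF assms(2)] xy by simp
    ultimately show ?thesis
      using bij_betw_inv_into_left[OF bij] xy by metis
  qed
  then show ?thesis
    using bij_betw_inv_into[OF bij] by (simp add: quandle_automorphism_def)
qed

text \<open>Unique division gives bijectivity, and self-distributivity is exactly compatibility with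
  the operation.\<close>

lemma quandle_automorphism_right_mult:
  assumes "quandle Q op" "b \<in> Q"
  shows "quandle_automorphism Q op (right_mult Q op b)"
proof -
  have "bij_betw (\<lambda>x. op x b) Q Q"
    unfolding bij_betw_def
  proof (intro conjI inj_onI equalityI subsetI)
    fix x y assume xy: "x \<in> Q" "y \<in> Q" "op x b = op y b"
    have "\<exists>!c. c \<in> Q \<and> op x b = op c b"
      using assms(1) quandle_closed[OF assms(1) xy(1) assms(2)] assms(2)
      by (rule quandle_div_unique)
    then show "x = y" using xy by (elim ex1E) metis
  next
    fix x assume "x \<in> (\<lambda>x. op x b) ` Q"
    then show "x \<in> Q" using quandle_closed[OF assms(1) _ assms(2)] by blast
  next
    fix x assume "x \<in> Q"
    then obtain c where "c \<in> Q" "x = op c b"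
      using quandle_div_unique[OF assms(1) _ assms(2)] by blast
    then show "x \<in> (\<lambda>x. op x b) ` Q" by blast
  qed
  then have "bij_betw (right_mult Q op b) Q Q"
    by (subst bij_betw_cong[of Q _ "\<lambda>x. op x b"]) (simp_all add: right_mult_apply)
  moreover have "right_mult Q op b (op x y) = op (right_mult Q op b x) (right_mult Q op b y)"
    if "x \<in> Q" "y \<in> Q" for x y
    using quandle_distrib[OF assms(1) that assms(2)] quandle_closed[OF assms(1) that] that
    by (simp only: right_mult_apply)
  ultimately show ?thesis
    unfolding quandle_automorphism_def by blast
qed

text \<open>Each step along an orbit applies some \<open>r_c\<close> or its inverse, both
  automorphisms; induction on the orbit composes these steps.\<close>

lemma connected_quandle_transitive:
  assumes "connected_quandle Q op" "a \<in> Q" "b \<in> Q"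
  obtains \<phi> where "quandle_automorphism Q op \<phi>" "\<phi> a = b"
proof -
  have Q: "quandle Q op" and orb: "quandle_orbit Q op a = Q"
    using assms unfolding connected_quandle_def by auto
  have "b \<in> quandle_orbit Q op a" using orb assms(3) by simp
  then have "\<exists>\<phi>. quandle_automorphism Q op \<phi> \<and> \<phi> a = b"
  proof induction
    case start
    show ?case using quandle_automorphism_id by force
  next
    case (mult x c)
    then obtain \<phi> where \<phi>: "quandle_automorphism Q op \<phi>" "\<phi> a = x" by blast
    have "(right_mult Q op c \<circ> \<phi>) a = op x c"
      using mult.hyps(1) orb \<phi>(2) by (simp add: right_mult_apply)
    moreover have "quandle_automorphism Q op (right_mult Q op c \<circ> \<phi>)"
      by (rule quandle_automorphism_comp[OF quandle_automorphism_right_mult[OF Q mult.hyps(2)] \<phi>(1)])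
    ultimately show ?case by blast
  next
    case (div x c)
    then obtain \<phi> where \<phi>: "quandle_automorphism Q op \<phi>" "\<phi> a = x" by blast
    let ?\<psi> = "inv_into Q (right_mult Q op c)"
    have "(?\<psi> \<circ> \<phi>) a = right_div Q op x c"
      using \<phi>(2) by (simp add: right_div_def)
    moreover have "quandle_automorphism Q op ?\<psi>"
      by (rule quandle_automorphism_inv_into[OF Q quandle_automorphism_right_mult[OF Q div.hyps(2)]])
    then have "quandle_automorphism Q op (?\<psi> \<circ> \<phi>)"
      using \<phi>(1) by (rule quandle_automorphism_comp)
    ultimately show ?case by blast
  qed
  then show ?thesis using that by blast
qed

section \<open>Reorderings composed with automorphisms\<close>

lemma reordered_matrix_automorphism:
  assumes "quandle {1..n} op" "bij_betw \<mu> {1..n} {1..n}" "quandle_automorphism {1..n} op \<phi>"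
  shows "reordered_matrix n op (\<mu> \<circ> \<phi>) = reordered_matrix n op \<mu>"
proof
  fix ab
  have \<phi>: "bij_betw \<phi> {1..n} {1..n}" using assms(3) by (simp add: quandle_automorphism_def)
  have \<mu>\<phi>: "bij_betw (\<mu> \<circ> \<phi>) {1..n} {1..n}" using bij_betw_trans[OF \<phi> assms(2)] .
  show "reordered_matrix n op (\<mu> \<circ> \<phi>) ab = reordered_matrix n op \<mu> ab"
  proof (cases "ab \<in> {1..n} \<times> {1..n}")
    case True
    then obtain x y where xy: "ab = (x, y)" "x \<in> {1..n}" "y \<in> {1..n}" by blast
    obtain a where a: "a \<in> {1..n}" "x = (\<mu> \<circ> \<phi>) a"
      using xy(2) bij_betw_imp_surj_on[OF \<mu>\<phi>] by (metis imageE)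
    obtain b where b: "b \<in> {1..n}" "y = (\<mu> \<circ> \<phi>) b"
      using xy(3) bij_betw_imp_surj_on[OF \<mu>\<phi>] by (metis imageE)
    \<comment> \<open>The position \<open>ab\<close> is read twice: as the image of
      \<open>(a, b)\<close> under \<open>\<mu> \<circ> \<phi>\<close>, and as the image of
      \<open>(\<phi> a, \<phi> b)\<close> under \<open>\<mu>\<close>.\<close>
    have "reordered_matrix n op (\<mu> \<circ> \<phi>) ab = \<mu> (\<phi> (op a b))"
      unfolding xy(1) a(2) b(2) using reordered_matrix_entry[OF \<mu>\<phi> a(1) b(1)] by simp
    also have "\<phi> (op a b) = op (\<phi> a) (\<phi> b)"
      using assms(3) a(1) b(1) by (rule quandle_automorphism_apply)
    also have "\<mu> \<dots> = reordered_matrix n op \<mu> ab"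
      unfolding xy(1) a(2) b(2) comp_apply
      using assms(2) bij_betw_apply[OF \<phi> a(1)] bij_betw_apply[OF \<phi> b(1)]
      by (rule reordered_matrix_entry[symmetric])
    finally show ?thesis .
  next
    case False
    \<comment> \<open>Off the index square both matrices take the default value of
      \<open>restrict\<close>.\<close>
    then show ?thesis by (simp only: reordered_matrix_def restrict_apply if_False)
  qed
qed

text \<open>The inverse \<open>\<psi>\<close> of \<open>\<phi>\<close> carries a presentation of the
  permutation at \<open>\<phi> p\<close> to one at \<open>p\<close> with the same lengths, and
  \<open>\<mu> \<circ> \<phi>\<close> takes on the new entries the values that \<open>\<mu>\<close>
  takes on the old ones.\<close>

lemma natural_reordering_automorphism:
  assumes "quandle {1..n} op" "quandle_automorphism {1..n} op \<phi>" "p \<in> {1..n}"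
    and "natural_reordering n op (\<phi> p) \<mu>"
  shows "natural_reordering n op p (\<mu> \<circ> \<phi>)"
proof -
  obtain k l i where \<mu>: "bij_betw \<mu> {1..n} {1..n}" "\<mu> (\<phi> p) = n"
      "\<forall>s\<in>{1..k}. \<forall>t\<in>{1..l s}. \<mu> (i s t) = (\<Sum>j=1..<s. l j) + t"
    and cp: "cycle_presentation n op (\<phi> p) k l i"
    using assms(4) unfolding natural_reordering_def by blast
  have \<phi>: "bij_betw \<phi> {1..n} {1..n}" using assms(2) by (simp add: quandle_automorphism_def)
  define \<psi> where "\<psi> = inv_into {1..n} \<phi>"
  have \<psi>: "quandle_automorphism {1..n} op \<psi>"
    unfolding \<psi>_def using assms(1,2) by (rule quandle_automorphism_inv_into)
  have \<psi>\<phi>: "\<psi> (\<phi> x) = x" if "x \<in> {1..n}" for x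
    unfolding \<psi>_def using \<phi> that by (rule bij_betw_inv_into_left)
  have \<phi>\<psi>: "\<phi> (\<psi> x) = x" if "x \<in> {1..n}" for x
    unfolding \<psi>_def using \<phi> that by (rule bij_betw_inv_into_right)
  have \<psi>b: "bij_betw \<psi> {1..n} {1..n}"
    using \<psi> by (simp add: quandle_automorphism_def)
  have \<phi>p: "\<phi> p \<in> {1..n}" using \<phi> assms(3) bij_betwE by blast
  have "bij_betw \<psi> ({1..n} - {\<phi> p}) ({1..n} - {p})"
    using bij_betw_DiffI[OF \<psi>b, of "{\<phi> p}" "{p}"] \<phi>p assms(3) \<psi>\<phi> by (simp add: bij_betw_def)
  moreover have cp_facts: "\<forall>s\<in>{1..k}. 1 \<le> l s" "mono_on {1..k} l"
      "bij_betw (\<lambda>(s, t). i s t) (SIGMA s:{1..k}. {1..l s}) ({1..n} - {\<phi> p})"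
    using cp unfolding cycle_presentation_iff by blast+
  ultimately have "bij_betw (\<psi> \<circ> (\<lambda>(s, t). i s t)) (SIGMA s:{1..k}. {1..l s}) ({1..n} - {p})"
    by (intro bij_betw_trans)
  then have "bij_betw (\<lambda>(s, t). \<psi> (i s t)) (SIGMA s:{1..k}. {1..l s}) ({1..n} - {p})"
    by (simp only: comp_def case_prod_unfold)
  moreover have "op (\<psi> (i s t)) p = \<psi> (i s (t mod l s + 1))"
    if st: "s \<in> {1..k}" "t \<in> {1..l s}" for s t
  proof -
    have "op (i s t) (\<phi> p) = i s (t mod l s + 1)"
      using cp st unfolding cycle_presentation_iff by blast
    moreover have "\<psi> (op (i s t) (\<phi> p)) = op (\<psi> (i s t)) (\<psi> (\<phi> p))"
      using cycle_presentation_in[OF cp st] \<phi>p by (intro quandle_automorphism_apply[OF \<psi>]) blast+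
    ultimately show ?thesis using \<psi>\<phi>[OF assms(3)] by simp
  qed
  ultimately have "cycle_presentation n op p k l (\<lambda>s t. \<psi> (i s t))"
    using cp_facts(1,2) assms(3) quandle_idem[OF assms(1,3)]
    unfolding cycle_presentation_iff by blast
  moreover have "(\<mu> \<circ> \<phi>) (\<psi> (i s t)) = (\<Sum>j=1..<s. l j) + t"
    if "s \<in> {1..k}" "t \<in> {1..l s}" for s t
    using \<mu>(3) that \<phi>\<psi> cycle_presentation_in[OF cp that] by simp
  moreover have "bij_betw (\<mu> \<circ> \<phi>) {1..n} {1..n}" using bij_betw_trans[OF \<phi> \<mu>(1)] .
  moreover have "(\<mu> \<circ> \<phi>) p = n" using \<mu>(2) by simp
  ultimately show ?thesis
    unfolding natural_reordering_def by blast
qed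

text \<open>This makes \<open>natural_reordering_at_profile\<close> applicable to the given order
  itself.\<close>

lemma naturally_ordered_imp_natural_reordering_id:
  "naturally_ordered n op \<Longrightarrow> natural_reordering n op n id"
  unfolding naturally_ordered_def natural_reordering_def by auto

section \<open>Choice of the reordering\<close>

lemma funpow_commute: "(f ^^ a) ((f ^^ b) x) = (f ^^ b) ((f ^^ a) x)"
  using fun_cong[OF funpow_add[of a b f], of x] fun_cong[OF funpow_add[of b a f], of x]
  by (simp add: add.commute)

theorem theorem1p5:
  fixes n k :: nat and op :: "nat \<Rightarrow> nat \<Rightarrow> nat" and l :: "nat \<Rightarrow> nat"
  assumes "connected_quandle {1..n} op"
    and "naturally_ordered n op"
    and "k \<ge> 1"
    and "\<forall>j\<in>{1..k}. 1 \<le> l j" and "mono_on {1..k} l"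
    and "profile n op = {#1#} + image_mset l (mset_set {1..k})"
  shows "\<forall>\<mu>. \<forall>q\<in>{1..n}. natural_reordering n op q \<mu> \<longrightarrow>
    (\<exists>\<nu>. natural_reordering n op n \<nu> \<and>
       reordered_matrix n op \<mu> = reordered_matrix n op \<nu> \<and>
       (\<exists>m\<in>{1..k}. l m = l k \<and>
          (\<forall>i\<in>{1..l m}. \<nu> ((\<Sum>j=1..<m. l j) + i) = (\<Sum>j=1..<k. l j) + i)) \<and>
       (k \<ge> 2 \<and> l (k - 1) < l k \<longrightarrow>
          (\<forall>i\<in>{(\<Sum>j=1..<k. l j) + 1..n}. \<nu> i = i)))"
proof (intro allI ballI impI)
  fix \<mu> q assume q: "q \<in> {1..n}" and \<mu>: "natural_reordering n op q \<mu>"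
  let ?S = "\<lambda>s. \<Sum>j=1..<s. l j"
  let ?r = "right_mult {1..n} op n"
  have Q: "quandle {1..n} op" using assms(1) by (simp add: connected_quandle_def)
  have n: "n \<in> {1..n}" using q by simp
  obtain \<phi> where \<phi>: "quandle_automorphism {1..n} op \<phi>" "\<phi> n = q"
    using connected_quandle_transitive[OF assms(1) n q] .
  obtain i where i: "cycle_presentation n op n k l i"
    and \<mu>\<phi>: "\<And>s t. s \<in> {1..k} \<Longrightarrow> t \<in> {1..l s} \<Longrightarrow> (\<mu> \<circ> \<phi>) (i s t) = ?S s + t"
    using natural_reordering_at_profile[OF natural_reordering_automorphism[OF Q \<phi>(1) n] assms(5,6)]
      \<mu> \<phi>(2) by blast
  obtain i' where i': "cycle_presentation n op n k l i'"
    and i'_eq: "\<And>s t. s \<in> {1..k} \<Longrightarrow> t \<in> {1..l s} \<Longrightarrow> id (i' s t) = ?S s + t"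
    using natural_reordering_at_profile[OF naturally_ordered_imp_natural_reordering_id assms(5,6)]
      assms(2) by blast
  \<comment> \<open>The given order, now with the prescribed lengths. Both \<open>i\<close> and the
    standard blocks present the same \<open>r_n\<close>.\<close>
  have std: "cycle_presentation n op n k l (\<lambda>s t. ?S s + t)"
    using refl i'_eq[unfolded id_apply] i' by (rule cycle_presentation_cong)
  have k: "k \<in> {1..k}" and one: "1 \<in> {1..l k}" using assms(3,4) by auto
  \<comment> \<open>Row \<open>k\<close> of \<open>i\<close> is what
    \<open>\<mu> \<circ> \<phi>\<close> sends to the last block; \<open>m\<close> is the standard
    block containing its first entry, at position \<open>t\<close>.\<close>
  obtain m t where m: "m \<in> {1..k}" and t: "t \<in> {1..l m}" and ik: "i k 1 = ?S m + t"
    using cycle_presentation_cases[OF std] cycle_presentation_in[OF i k one] by blast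
  \<comment> \<open>Both rows are the \<open>r_n\<close>-orbit of the same point, so they have the
    same cardinality.\<close>
  have lm: "l m = l k"
    using cycle_presentation_orbit[OF i k one] cycle_presentation_card[OF i k]
      cycle_presentation_orbit[OF std m t] cycle_presentation_card[OF std m] ik by metis
  \<comment> \<open>The power of \<open>r\<^sub>n\<close> rotates the \<open>m\<close>-th cycle so that its first element goes to the
    first element of the last cycle of the transported presentation.\<close>
  define \<psi> where "\<psi> = \<phi> \<circ> ?r ^^ (t - 1)"
  have rn: "(?r ^^ d) n = n" for d
    using quandle_idem[OF Q n] right_mult_apply[OF n, of op n]
    by (induction d) (simp_all only: funpow.simps comp_apply id_apply)
  have \<psi>: "quandle_automorphism {1..n} op \<psi>"
    unfolding \<psi>_def
    by (rule quandle_automorphism_comp[OF \<phi>(1)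
          quandle_automorphism_funpow[OF quandle_automorphism_right_mult[OF Q n]]])
  have \<psi>n: "\<psi> n = q"
    unfolding \<psi>_def using \<phi>(2) by (simp only: comp_apply rn)
  have nat: "natural_reordering n op n (\<mu> \<circ> \<psi>)"
    using natural_reordering_automorphism[OF Q \<psi> n] \<mu> \<psi>n by simp
  have \<mu>bij: "bij_betw \<mu> {1..n} {1..n}" and \<mu>q: "\<mu> q = n"
    using \<mu> by (auto simp: natural_reordering_def)
  have last: "(\<mu> \<circ> \<psi>) (?S m + j) = ?S k + j" if j: "j \<in> {1..l m}" for j
  proof -
    note first = cycle_presentation_funpow_first[OF std m]
    have "(?r ^^ (t - 1)) (?S m + j) = (?r ^^ (j - 1)) (i k 1)"
      \<comment> \<open>Entries of block \<open>m\<close> are powers of \<open>r_n\<close> applied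
        to its first entry, so the shifts by \<open>t - 1\<close> and \<open>j - 1\<close> can be
        exchanged.\<close>
      unfolding ik first[OF j, symmetric] first[OF t, symmetric] by (rule funpow_commute)
    also have "\<dots> = i k j"
      using cycle_presentation_funpow_first[OF i k] j lm by simp
    finally show ?thesis using \<mu>\<phi>[OF k] j lm by (simp add: \<psi>_def)
  qed
  \<comment> \<open>The point \<open>n\<close> lies in no block and is treated separately. A
    strictly longest last block leaves only \<open>m = k\<close>, and any other point beyond
    \<open>?S k\<close> lies in that block, where \<open>last\<close> gives the identity.\<close>
  have "(\<mu> \<circ> \<psi>) x = x" if gap: "k \<ge> 2" "l (k - 1) < l k" and x: "x \<in> {?S k + 1..n}" for x
  proof (cases "x = n")
    case True
    then show ?thesis using \<psi>n \<mu>q by simp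
  next
    case False
    have mk: "m = k"
    proof (rule ccontr)
      assume "m \<noteq> k"
      then have "l m \<le> l (k - 1)"
        using m gap(1) by (intro mono_onD[OF assms(5)]) auto
      then show False using lm gap(2) by simp
    qed
    obtain s t where st: "s \<in> {1..k}" "t \<in> {1..l s}" "x = ?S s + t"
      using cycle_presentation_cases[OF std _ False] x by auto
    have "s = k"
    proof (rule ccontr)
      assume "s \<noteq> k"
      \<comment> \<open>An earlier block ends at \<open>?S (Suc s)\<close>, which is at most
        \<open>?S k\<close> and hence below \<open>x\<close>.\<close>
      then have "?S (Suc s) \<le> ?S k" using st(1) by (intro sum_mono2) auto
      moreover have "?S (Suc s) = ?S s + l s" using st(1) by simp
      ultimately show False using st(2,3) x by simp
    qed
    then show ?thesis using last[of t] st(2,3) mk by simp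
  qed
  then show "\<exists>\<nu>. natural_reordering n op n \<nu> \<and>
       reordered_matrix n op \<mu> = reordered_matrix n op \<nu> \<and>
       (\<exists>m\<in>{1..k}. l m = l k \<and>
          (\<forall>i\<in>{1..l m}. \<nu> (?S m + i) = ?S k + i)) \<and>
       (k \<ge> 2 \<and> l (k - 1) < l k \<longrightarrow> (\<forall>i\<in>{?S k + 1..n}. \<nu> i = i))"
    using nat reordered_matrix_automorphism[OF Q \<mu>bij \<psi>] m lm last
    by (intro exI[of _ "\<mu> \<circ> \<psi>"]) auto
qed

end
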